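(* There exist translation surfaces with horizontal saddle connections whose orbit under backward Rauzy-Veech induction is defined indefinitely. That is, there exist a finite alphabet $\mathcal A$ and $\pi\in S_0^{\mathcal A}$, $\lambda\in\mathbb R_{>0}^{\mathcal A}$, $\tau\in\Theta^{\mathcal A}(\pi)$ such that the translation surface $(\pi,\lambda,\tau)$ has a horizontal saddle connection and $\mathbf R^{-n}(\pi,\lambda,\tau)$ is defined for every $n\in\mathbb N$.
   Context: Let $\mathcal A$ be a finite alphabet, $d=\#\mathcal A\ge2$. $S_0^{\mathcal A}$ is the set of irreducible permutations: pairs $\pi=(\pi_0,\pi_1)$ of bijections $\pi_0,\pi_1:\mathcal A\to\{1,\dots,d\}$ such that, for $1\le k\le d$, $\pi_1\circ\pi_0^{-1}\{1,\dots,k\}=\{1,\dots,k\}$ implies $k=d$. For $\pi\in S_0^{\mathcal A}$, $\Theta^{\mathcal A}(\pi)$ is the set of $\tau\in\mathbb R^{\mathcal A}$ such that $\sum_{\alpha:\pi_0(\alpha)\le k}\tau_\alpha>0$ and $\sum_{\alpha:\pi_1(\alpha)\le k}\tau_\alpha<0$ for every $k\in\{1,\dots,d-1\}$. Translation surface. For $\lambda\in\mathbb R_{>0}^{\mathcal A}$ and $\tau\in\Theta^{\mathcal A}(\pi)$, the triple $(\pi,\lambda,\tau)$ is identified with the following translation surface. In $\mathbb C$ put $a_k=\sum_{\alpha:\pi_0(\alpha)\le k}(\lambda_\alpha+i\tau_\alpha)$ and $b_k=\sum_{\alpha:\pi_1(\alpha)\le k}(\lambda_\alpha+i\tau_\alpha)$,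 $0\le k\le d$. The polygon of $(\pi,\lambda,\tau)$ is bounded by the two broken lines with successive vertices $a_0,\dots,a_d$ and $b_0,\dots,b_d$ ($a_0=b_0=0$, $a_d=b_d$). For each $\alpha$ the sides $[a_{\pi_0(\alpha)-1},a_{\pi_0(\alpha)}]$ and $[b_{\pi_1(\alpha)-1},b_{\pi_1(\alpha)}]$ are identified by translation. The set $\Sigma$ of singularities is the image of the vertices (conical singularities as well as marked points). Horizontal saddle connections. The horizontal flow moves every non-singular point rightwards at unit speed. A (horizontal) separatrix is an orbit hitting $\Sigma$: it is rightward if the singularity is hit in negative time and leftward if it is hit in positive time. A horizontal saddle connection is a separatrix that is both rightward and leftward. Rauzy-Veech induction. $\mathbf R(\pi,\lambda,\tau)=(\pi^1,\lambda^1,\tau^1)$ is defined when $\lambda_{\pi_0^{-1}(d)}\ne\lambda_{\pi_1^{-1}(d)}$. If $\lambda_{\pi_0^{-1}(d)}>\lambda_{\pi_1^{-1}(d)}$ ("top" type), set $w=\pi_0^{-1}(d)$, $l=\pi_1^{-1}(d)$, $\pi^1_0=\pi_0$, and obtain $\pi^1_1$ from $\pi_1$ by moving $l$ to the position immediately after $w$ (shifting by one the letters in between). If $\lambda_{\pi_0^{-1}(d)}<\lambda_{\pi_1^{-1}(d)}$ ("bottom" type), set $w=\pi_1^{-1}(d)$, $l=\pi_0^{-1}(d)$, $\pi^1_1=\pi_1$, and obtain $\pi_0^1$ from $\pi_0$ by moving $l$ to the position immediately after $w$. In both cases $\lambda^1_w=\lambda_w-\lambda_l$, $\tau^1_w=\tau_w-\tau_l$,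 and the other coordinates of $\lambda,\tau$ are unchanged. Backward Rauzy-Veech induction. $\mathbf R$ is invertible at triples with $\sum_{\alpha}\tau_\alpha\ne0$: such $(\pi,\lambda,\tau)$ has a unique preimage $\mathbf R^{-1}(\pi,\lambda,\tau)$ among triples with $\pi\in S_0^{\mathcal A}$, $\lambda\in\mathbb R^{\mathcal A}_{>0}$, $\tau\in\Theta^{\mathcal A}(\pi)$. If $\sum_\alpha\tau_\alpha=0$, then $\mathbf R^{-1}$ is not defined and the backward algorithm stops. $\mathbf R^{-n}$ denotes the $n$-th iterate of $\mathbf R^{-1}$, when defined. *)

theory Defs
  imports "HOL-Analysis.Analysis"
begin

text \<open>
  A datum is a triple of a pair of bijections from the alphabet to \<open>{1..d}\<close>, a length vector and a
  suspension vector. Vectors in \<open>\<real>\<^sup>A\<close> and maps on the alphabet \<open>A\<close> are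
  extensional functions, so that equality of data is equality over \<open>A\<close>.
\<close>

type_synonym 'a perm_pair = "('a \<Rightarrow> nat) \<times> ('a \<Rightarrow> nat)"
type_synonym 'a datum = "'a perm_pair \<times> ('a \<Rightarrow> real) \<times> ('a \<Rightarrow> real)"

definition irreducible_perms :: "'a set \<Rightarrow> 'a perm_pair set" where
  "irreducible_perms A = {(p0, p1).
     p0 \<in> extensional A \<and> p1 \<in> extensional A \<and>
     bij_betw p0 A {1..card A} \<and> bij_betw p1 A {1..card A} \<and>
     (\<forall>k\<in>{1..card A}. (p1 \<circ> inv_into A p0) ` {1..k} = {1..k} \<longrightarrow> k = card A)}"

definition suspension_cone :: "'a set \<Rightarrow> 'a perm_pair \<Rightarrow> ('a \<Rightarrow> real) set" where
  "suspension_cone A = (\<lambda>(p0, p1). {\<tau> \<in> extensional A. \<forall>k\<in>{1..card A - 1}.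
     (\<Sum>\<alpha> | \<alpha> \<in> A \<and> p0 \<alpha> \<le> k. \<tau> \<alpha>) > 0 \<and> (\<Sum>\<alpha> | \<alpha> \<in> A \<and> p1 \<alpha> \<le> k. \<tau> \<alpha>) < 0})"

definition suspension_data :: "'a set \<Rightarrow> 'a datum set" where
  "suspension_data A = {(\<pi>, len, \<tau>).
     \<pi> \<in> irreducible_perms A \<and> len \<in> A \<rightarrow>\<^sub>E {0<..} \<and> \<tau> \<in> suspension_cone A \<pi>}"


subsection \<open>The translation surface of a datum\<close>

definition vertex :: "'a set \<Rightarrow> ('a \<Rightarrow> nat) \<Rightarrow> ('a \<Rightarrow> real) \<Rightarrow> ('a \<Rightarrow> real) \<Rightarrow> nat \<Rightarrow> complex" where
  "vertex A p len \<tau> k = (\<Sum>\<alpha> | \<alpha> \<in> A \<and> p \<alpha> \<le> k. Complex (len \<alpha>) (\<tau> \<alpha>))"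

definition side :: "'a set \<Rightarrow> ('a \<Rightarrow> nat) \<Rightarrow> ('a \<Rightarrow> real) \<Rightarrow> ('a \<Rightarrow> real) \<Rightarrow> 'a \<Rightarrow> complex set" where
  "side A p len \<tau> \<alpha> = closed_segment (vertex A p len \<tau> (p \<alpha> - 1)) (vertex A p len \<tau> (p \<alpha>))"

definition broken_line :: "'a set \<Rightarrow> ('a \<Rightarrow> nat) \<Rightarrow> ('a \<Rightarrow> real) \<Rightarrow> ('a \<Rightarrow> real) \<Rightarrow> complex set" where
  "broken_line A p len \<tau> =
     (\<Union>k\<in>{1..card A}. closed_segment (vertex A p len \<tau> (k - 1)) (vertex A p len \<tau> k))"

text \<open>
  Each broken line is the graph of a function of the real part, but for some data the two lines
  cross and do not bound a polygon. The constructions below are meant for data satisfying: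
\<close>

definition bounds_polygon :: "'a set \<Rightarrow> 'a datum \<Rightarrow> bool" where
  "bounds_polygon A = (\<lambda>((p0, p1), len, \<tau>).
     broken_line A p0 len \<tau> \<inter> broken_line A p1 len \<tau> = {0, vertex A p0 len \<tau> (card A)})"

definition polygon :: "'a set \<Rightarrow> 'a datum \<Rightarrow> complex set" where
  "polygon A = (\<lambda>((p0, p1), len, \<tau>).
     let L = broken_line A p0 len \<tau> \<union> broken_line A p1 len \<tau> in L \<union> inside L)"

definition side_pairing :: "'a set \<Rightarrow> 'a datum \<Rightarrow> (complex \<times> complex) set" where
  "side_pairing A = (\<lambda>((p0, p1), len, \<tau>).
     {(z, z + (vertex A p1 len \<tau> (p1 \<alpha> - 1) - vertex A p0 len \<tau> (p0 \<alpha> - 1))) |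
        z \<alpha>. \<alpha> \<in> A \<and> z \<in> side A p0 len \<tau> \<alpha>})"

definition gluing :: "'a set \<Rightarrow> 'a datum \<Rightarrow> (complex \<times> complex) set" where
  "gluing A T = (side_pairing A T \<union> (side_pairing A T)\<inverse>)\<^sup>* \<inter> polygon A T \<times> polygon A T"

definition surface :: "'a set \<Rightarrow> 'a datum \<Rightarrow> complex set set" where
  "surface A T = polygon A T // gluing A T"

definition singularities :: "'a set \<Rightarrow> 'a datum \<Rightarrow> complex set set" where
  "singularities A = (\<lambda>((p0, p1), len, \<tau>).
     (\<Union>k\<in>{0..card A}. {gluing A ((p0, p1), len, \<tau>) `` {vertex A p0 len \<tau> k},
                       gluing A ((p0, p1), len, \<tau>) `` {vertex A p1 len \<tau> k}}))"


subsection \<open>Horizontal saddle connections\<close>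

text \<open>
  The curve \<open>\<gamma>\<close> moves rightwards at unit speed on the interval \<open>J\<close>: near each time \<open>t\<close>, on either side
  of \<open>t\<close>, it is the image of a horizontal segment of the polygon issuing from a representative \<open>z\<close> of
  \<open>\<gamma> t\<close>. The representatives used before and after \<open>t\<close> differ when a side is crossed. Points
  outside the polygon have an empty image, which is not in the surface.
\<close>

definition horizontal_motion :: "'a set \<Rightarrow> 'a datum \<Rightarrow> (real \<Rightarrow> complex set) \<Rightarrow> real set \<Rightarrow> bool" where
  "horizontal_motion A T \<gamma> J \<longleftrightarrow>
     \<gamma> ` J \<subseteq> surface A T \<and>
     (\<forall>t\<in>J. (\<exists>z\<in>\<gamma> t. \<exists>\<epsilon>>0. \<forall>s \<in> J \<inter> {t..<t + \<epsilon>}. \<gamma> s = gluing A T `` {z + of_real (s - t)}) \<and>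
            (\<exists>z\<in>\<gamma> t. \<exists>\<epsilon>>0. \<forall>s \<in> J \<inter> {t - \<epsilon><..t}. \<gamma> s = gluing A T `` {z + of_real (s - t)}))"

text \<open>
  The flow takes \<open>p\<close> to \<open>q\<close> in time \<open>t\<close>, possibly negative; \<open>q\<close> may be a singularity,
  in which case it is the first one met.
\<close>

definition flows_to :: "'a set \<Rightarrow> 'a datum \<Rightarrow> complex set \<Rightarrow> real \<Rightarrow> complex set \<Rightarrow> bool" where
  "flows_to A T p t q \<longleftrightarrow>
     (\<exists>\<gamma>. horizontal_motion A T \<gamma> (closed_segment 0 t) \<and> \<gamma> 0 = p \<and> \<gamma> t = q \<and>
          (\<forall>s\<in>open_segment 0 t. \<gamma> s \<notin> singularities A T))"

definition horizontal_orbit :: "'a set \<Rightarrow> 'a datum \<Rightarrow> complex set \<Rightarrow> complex set set" where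
  "horizontal_orbit A T p = {q. q \<notin> singularities A T \<and> (\<exists>t. flows_to A T p t q)}"

definition rightward_separatrix :: "'a set \<Rightarrow> 'a datum \<Rightarrow> complex set set \<Rightarrow> bool" where
  "rightward_separatrix A T orb \<longleftrightarrow>
     (\<exists>p \<in> surface A T - singularities A T. orb = horizontal_orbit A T p \<and>
        (\<exists>t<0. \<exists>q\<in>singularities A T. flows_to A T p t q))"

definition leftward_separatrix :: "'a set \<Rightarrow> 'a datum \<Rightarrow> complex set set \<Rightarrow> bool" where
  "leftward_separatrix A T orb \<longleftrightarrow>
     (\<exists>p \<in> surface A T - singularities A T. orb = horizontal_orbit A T p \<and>
        (\<exists>t>0. \<exists>q\<in>singularities A T. flows_to A T p t q))"

definition horizontal_saddle_connection :: "'a set \<Rightarrow> 'a datum \<Rightarrow> complex set set \<Rightarrow> bool" where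
  "horizontal_saddle_connection A T orb \<longleftrightarrow>
     rightward_separatrix A T orb \<and> leftward_separatrix A T orb"


subsection \<open>Rauzy--Veech induction and its inverse\<close>

text \<open>Only used when \<open>l\<close> occupies the last position.\<close>

definition move_after :: "'a set \<Rightarrow> ('a \<Rightarrow> nat) \<Rightarrow> 'a \<Rightarrow> 'a \<Rightarrow> 'a \<Rightarrow> nat" where
  "move_after A p w l = restrict (\<lambda>\<beta>.
     if \<beta> = l then p w + 1 else if p \<beta> \<le> p w then p \<beta> else p \<beta> + 1) A"

definition rauzy_veech :: "'a set \<Rightarrow> 'a datum \<Rightarrow> 'a datum option" where
  "rauzy_veech A = (\<lambda>((p0, p1), len, \<tau>).
     let t = inv_into A p0 (card A); b = inv_into A p1 (card A) in
     if len t > len b then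
       Some ((p0, move_after A p1 t b), len(t := len t - len b), \<tau>(t := \<tau> t - \<tau> b))
     else if len t < len b then
       Some ((move_after A p0 b t, p1), len(b := len b - len t), \<tau>(b := \<tau> b - \<tau> t))
     else None)"

text \<open>
  If the total of \<open>\<tau>\<close> is nonzero the preimage exists and is unique; if it is zero there is none.
\<close>

definition rauzy_veech_inv :: "'a set \<Rightarrow> 'a datum \<Rightarrow> 'a datum option" where
  "rauzy_veech_inv A = (\<lambda>(\<pi>, len, \<tau>).
     if (\<Sum>\<alpha>\<in>A. \<tau> \<alpha>) \<noteq> 0
     then Some (THE T'. T' \<in> suspension_data A \<and> rauzy_veech A T' = Some (\<pi>, len, \<tau>))
     else None)"

primrec rauzy_veech_inv_iter :: "'a set \<Rightarrow> nat \<Rightarrow> 'a datum \<Rightarrow> 'a datum option" where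
  "rauzy_veech_inv_iter A 0 T = Some T"
| "rauzy_veech_inv_iter A (Suc n) T = Option.bind (rauzy_veech_inv_iter A n T) (rauzy_veech_inv A)"

end

theory Submission
  imports Defs
begin

text \<open>
  A side of the polygon with \<open>\<tau>\<^sub>\<alpha> = 0\<close> is a horizontal segment between two singularities, hence a
  saddle connection, and a datum with such a side can still have an infinite backward orbit. On
  three letters with \<open>\<pi> = (1 2 3 / 3 2 1)\<close>, take \<open>\<tau> = (x, 0, -y)\<close> with \<open>x, y > 0\<close>. The conditions of the
  suspension cone are strict only for partial sums, so they allow \<open>\<tau>\<^sub>2 = 0\<close>. Two backward steps lead
  back to the same permutation, and the middle coordinate, being zero, contributes nothing to the
  others: their effect on \<open>(x, y)\<close> is to subtract the smaller number from the larger one. The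
  backward algorithm is thus the subtractive Euclidean algorithm on \<open>(x, y)\<close>. It stops only at a pair
  of equal numbers, and none is reached from an irrational quotient \<open>x / y\<close>, because irrationality is
  inherited by the quotient of the new pair (\<open>euclid_datum_step\<close>).

  The backward step is a definite description, so finding one preimage does not compute it;
  uniqueness is needed too. It is the general fact that Rauzy--Veech induction is injective on
  suspension data (\<open>rauzy_veech_inj\<close>): the sign of the new total of \<open>\<tau>\<close> reveals the type of the
  step, and the loser is the letter placed right after the winner.

  The Euclidean algorithm acts on \<open>\<tau>\<close> alone, which leaves the lengths free; all of them are \<open>1\<close>. Then
  the vertices have integer real parts, on both broken lines the side \<open>2\<close> is the only one that enters
  the strip of real parts strictly between \<open>1\<close> and \<open>2\<close>, and its two copies are glued vertically. So no
  point of the strip is identified with a vertex (\<open>flat_middle_regular\<close>), and the flow along the side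
  \<open>2\<close> meets no singularity before its ends.
\<close>

section \<open>Rauzy--Veech induction is injective\<close>

lemma
  assumes "finite A" "A \<noteq> {}" and bij: "bij_betw p A {1..card A}"
  shows last_letter_in: "inv_into A p (card A) \<in> A"
    and last_letter_position: "p (inv_into A p (card A)) = card A"
    and sum_before_last: "(\<Sum>\<alpha> | \<alpha> \<in> A \<and> p \<alpha> \<le> card A - 1. \<tau> \<alpha>)
      = (\<Sum>\<alpha>\<in>A. \<tau> \<alpha>) - (\<tau> (inv_into A p (card A)) :: real)"
proof -
  let ?l = "inv_into A p (card A)"
  have c: "card A \<ge> 1"
    using assms by (simp add: Suc_leI card_gt_0_iff)
  then have im: "card A \<in> p ` A"
    using bij by (simp add: bij_betw_def)
  show l: "?l \<in> A" and pl: "p ?l = card A"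
    using im by (simp_all add: inv_into_into f_inv_into_f)
  have "p \<alpha> \<le> card A - 1 \<longleftrightarrow> \<alpha> \<noteq> ?l" if "\<alpha> \<in> A" for \<alpha>
  proof -
    have "p \<alpha> \<le> card A"
      using bij that by (auto simp: bij_betw_def)
    moreover have "p \<alpha> = card A \<longleftrightarrow> \<alpha> = ?l"
      using bij that l pl by (metis bij_betw_imp_inj_on inj_onD)
    ultimately show ?thesis
      using c by auto
  qed
  then have "{\<alpha>. \<alpha> \<in> A \<and> p \<alpha> \<le> card A - 1} = A - {?l}"
    by auto
  then show "(\<Sum>\<alpha> | \<alpha> \<in> A \<and> p \<alpha> \<le> card A - 1. \<tau> \<alpha>) = (\<Sum>\<alpha>\<in>A. \<tau> \<alpha>) - \<tau> ?l"
    using l \<open>finite A\<close> by (simp add: sum_diff1)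
qed

lemma sum_subtract_at:
  assumes "finite A" "w \<in> A"
  shows "(\<Sum>\<alpha>\<in>A. (\<tau>(w := \<tau> w - c)) \<alpha>) = (\<Sum>\<alpha>\<in>A. \<tau> \<alpha>) - (c :: real)"
  using assms by (simp add: sum.remove[of A w])

text \<open>
  The winner keeps its position and the loser stands right after it, so the new row determines which
  letter was moved; putting it back at the end recovers the old row.
\<close>

lemma move_after_inject:
  assumes p: "bij_betw p A {1..card A}" "p \<in> extensional A"
    and q: "bij_betw q A {1..card A}" "q \<in> extensional A"
    and l: "l \<in> A" "p l = card A" "l \<noteq> w"
    and m: "m \<in> A" "q m = card A" "m \<noteq> w"
    and w: "w \<in> A"
    and eq: "move_after A p w l = move_after A q w m"
  shows "l = m" "p = q"
proof -
  have E: "move_after A p w l \<beta> = move_after A q w m \<beta>" for \<beta>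
    using eq by simp
  have pw: "p w = q w"
    using E[of w] w l m by (simp add: move_after_def)
  show lm: "l = m"
  proof (rule ccontr)
    assume "l \<noteq> m"
    moreover have "p m \<noteq> p w"
      using p m w by (metis bij_betw_imp_inj_on inj_onD)
    ultimately show False
      using E[of m] m pw by (auto simp: move_after_def split: if_splits)
  qed
  show "p = q"
  proof (rule extensionalityI[OF p(2) q(2)])
    fix \<beta> assume "\<beta> \<in> A"
    then show "p \<beta> = q \<beta>"
      using E[of \<beta>] pw lm l(2) m(2) by (cases "\<beta> = l") (auto simp: move_after_def split: if_splits)
  qed
qed

lemma subtract_at_inject:
  assumes "f(w := f w - f l) = g(w := g w - (g l :: real))" "l \<noteq> w"
  shows "f = g"
proof
  fix x
  have "f l = g l" using fun_cong[OF assms(1), of l] assms(2) by simp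
  then show "f x = g x" using fun_cong[OF assms(1), of x] by (cases "x = w") auto
qed

text \<open>
  Subtracting \<open>\<tau>\<^sub>l\<close> from \<open>\<tau>\<^sub>w\<close> makes the new total equal to the old one without the loser. As the loser
  is the last letter of its row, this is the partial sum of the first \<open>d - 1\<close> letters of that row, and
  the suspension cone prescribes its sign. The new datum therefore remembers the type of the step.
\<close>

lemma rauzy_veech_Some_cases:
  assumes A: "finite A" "card A \<ge> 2" and T: "((p0, p1), len, \<tau>) \<in> suspension_data A"
    and R: "rauzy_veech A ((p0, p1), len, \<tau>) = Some ((q0, q1), len', \<tau>')"
  defines "t \<equiv> inv_into A p0 (card A)" and "b \<equiv> inv_into A p1 (card A)"
  obtains
    (top) "(\<Sum>\<alpha>\<in>A. \<tau>' \<alpha>) < 0" "b \<noteq> t" "q0 = p0" "q1 = move_after A p1 t b"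
      "len' = len(t := len t - len b)" "\<tau>' = \<tau>(t := \<tau> t - \<tau> b)"
  | (bottom) "(\<Sum>\<alpha>\<in>A. \<tau>' \<alpha>) > 0" "t \<noteq> b" "q1 = p1" "q0 = move_after A p0 b t"
      "len' = len(b := len b - len t)" "\<tau>' = \<tau>(b := \<tau> b - \<tau> t)"
proof -
  have fin: "finite A" "A \<noteq> {}"
    using A by auto
  have bij: "bij_betw p0 A {1..card A}" "bij_betw p1 A {1..card A}"
    and cone: "\<forall>k\<in>{1..card A - 1}. (\<Sum>\<alpha> | \<alpha> \<in> A \<and> p0 \<alpha> \<le> k. \<tau> \<alpha>) > 0 \<and>
      (\<Sum>\<alpha> | \<alpha> \<in> A \<and> p1 \<alpha> \<le> k. \<tau> \<alpha>) < 0"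
    using T by (auto simp: suspension_data_def irreducible_perms_def suspension_cone_def)
  have k: "card A - 1 \<in> {1..card A - 1}"
    using A(2) by simp
  have "(\<Sum>\<alpha>\<in>A. \<tau> \<alpha>) - \<tau> t > 0" "(\<Sum>\<alpha>\<in>A. \<tau> \<alpha>) - \<tau> b < 0"
    using bspec[OF cone k] sum_before_last[OF fin bij(1), of \<tau>]
      sum_before_last[OF fin bij(2), of \<tau>]
    unfolding t_def b_def by simp_all
  then have s: "(\<Sum>\<alpha>\<in>A. (\<tau>(b := \<tau> b - \<tau> t)) \<alpha>) > 0" "(\<Sum>\<alpha>\<in>A. (\<tau>(t := \<tau> t - \<tau> b)) \<alpha>) < 0"
    using last_letter_in[OF fin bij(1)] last_letter_in[OF fin bij(2)] sum_subtract_at[OF fin(1)]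
    unfolding t_def b_def by presburger+
  consider "len t > len b" | "len t < len b"
    using R unfolding rauzy_veech_def t_def b_def by (fastforce simp: Let_def split: if_splits)
  then show ?thesis
  proof cases
    case 1
    with R s(2) show ?thesis
      by (intro top) (auto simp: rauzy_veech_def Let_def simp flip: t_def b_def)
  next
    case 2
    with R s(1) show ?thesis
      by (intro bottom) (auto simp: rauzy_veech_def Let_def simp flip: t_def b_def)
  qed
qed

theorem rauzy_veech_inj:
  assumes fin: "finite A" "card A \<ge> 2"
    and T: "T \<in> suspension_data A" "T' \<in> suspension_data A"
    and eq: "rauzy_veech A T = Some U" "rauzy_veech A T' = Some U"
  shows "T = T'"
proof -
  obtain p0 p1 len \<tau> where T1: "T = ((p0, p1), len, \<tau>)" by (metis prod.collapse)
  obtain p0' p1' len' \<tau>' where T2: "T' = ((p0', p1'), len', \<tau>')" by (metis prod.collapse)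
  obtain q0 q1 lenU \<tau>U where U: "U = ((q0, q1), lenU, \<tau>U)" by (metis prod.collapse)
  have ne: "A \<noteq> {}" using fin by auto
  have 1: "bij_betw p0 A {1..card A}" "p0 \<in> extensional A"
       "bij_betw p1 A {1..card A}" "p1 \<in> extensional A"
    using T(1) unfolding T1 by (auto simp: suspension_data_def irreducible_perms_def)
  have 2: "bij_betw p0' A {1..card A}" "p0' \<in> extensional A"
       "bij_betw p1' A {1..card A}" "p1' \<in> extensional A"
    using T(2) unfolding T2 by (auto simp: suspension_data_def irreducible_perms_def)
  note last = last_letter_in[OF fin(1) ne] last_letter_position[OF fin(1) ne]
  from fin T(1)[unfolded T1] eq(1)[unfolded T1 U]
  show ?thesis
  proof (cases rule: rauzy_veech_Some_cases)
    case t: top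
    from fin T(2)[unfolded T2] eq(2)[unfolded T2 U]
    show ?thesis
    proof (cases rule: rauzy_veech_Some_cases)
      case t': top
      have p0: "p0' = p0"
        using t t' by simp
      have "inv_into A p1 (card A) = inv_into A p1' (card A)" "p1 = p1'"
        using move_after_inject[OF 1(3,4) 2(3,4) last(1)[OF 1(3)] last(2)[OF 1(3)] t(2)
            last(1)[OF 2(3)] last(2)[OF 2(3)] _ last(1)[OF 1(1)]] t(4) t'(2,4) p0 by auto
      moreover have "len = len'"
        using subtract_at_inject[OF _ t(2), of len len'] t(5) t'(5) p0 calculation by metis
      moreover have "\<tau> = \<tau>'"
        using subtract_at_inject[OF _ t(2), of \<tau> \<tau>'] t(6) t'(6) p0 calculation by metis
      ultimately show ?thesis
        using T1 T2 p0 by simp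
    next
      case bottom
      with t show ?thesis by simp
    qed
  next
    case b: bottom
    from fin T(2)[unfolded T2] eq(2)[unfolded T2 U]
    show ?thesis
    proof (cases rule: rauzy_veech_Some_cases)
      case b': bottom
      have p1: "p1' = p1"
        using b b' by simp
      have "inv_into A p0 (card A) = inv_into A p0' (card A)" "p0 = p0'"
        using move_after_inject[OF 1(1,2) 2(1,2) last(1)[OF 1(1)] last(2)[OF 1(1)] b(2)
            last(1)[OF 2(1)] last(2)[OF 2(1)] _ last(1)[OF 1(3)]] b(4) b'(2,4) p1 by auto
      moreover have "len = len'"
        using subtract_at_inject[OF _ b(2), of len len'] b(5) b'(5) p1 calculation by metis
      moreover have "\<tau> = \<tau>'"
        using subtract_at_inject[OF _ b(2), of \<tau> \<tau>'] b(6) b'(6) p1 calculation by metis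
      ultimately show ?thesis
        using T1 T2 p1 by simp
    next
      case top
      with b show ?thesis by simp
    qed
  qed
qed

lemma rauzy_veech_inv_eqI:
  assumes "finite A" "card A \<ge> 2"
    and T: "T \<in> suspension_data A" and R: "rauzy_veech A T = Some U"
  shows "rauzy_veech_inv A U = Some T"
proof -
  obtain p0 p1 len \<tau> where T1: "T = ((p0, p1), len, \<tau>)" by (metis prod.collapse)
  obtain q0 q1 len' \<tau>' where U: "U = ((q0, q1), len', \<tau>')" by (metis prod.collapse)
  from assms(1,2) T[unfolded T1] R[unfolded T1 U]
  have "(\<Sum>\<alpha>\<in>A. \<tau>' \<alpha>) \<noteq> 0"
    by (cases rule: rauzy_veech_Some_cases) auto
  moreover have "(THE T'. T' \<in> suspension_data A \<and> rauzy_veech A T' = Some U) = T"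
    using rauzy_veech_inj[OF assms(1,2)] T R by (intro the_equality) auto
  ultimately show ?thesis
    by (simp add: rauzy_veech_inv_def U)
qed

section \<open>Backward induction on three letters\<close>

text \<open>
  All vectors and permutations needed here are given by their values at the letters \<open>1\<close>, \<open>2\<close>, \<open>3\<close>. For
  a permutation these are positions, so \<open>row 2 3 1\<close> stands for the word \<open>3 1 2\<close>.
\<close>

definition row :: "'b \<Rightarrow> 'b \<Rightarrow> 'b \<Rightarrow> nat \<Rightarrow> 'b" where
  "row u v w = (\<lambda>i\<in>{1, 2, 3}. if i = 1 then u else if i = 2 then v else w)"

lemma row_simps [simp]: "row u v w (Suc 0) = u" "row u v w 2 = v" "row u v w 3 = w"
  by (simp_all add: row_def)

lemma row_extensional [simp]: "row u v w \<in> extensional {Suc 0, 2, 3}"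
  by (simp add: row_def)

lemma row_eqI:
  assumes "f \<in> extensional {1, 2, 3}" "f 1 = u" "f 2 = v" "f 3 = w"
  shows "f = row u v w"
  by (rule extensionalityI[OF assms(1)]) (use assms(2-) in auto)

lemma interval_simps: "{Suc 0..3} = {Suc 0, 2, 3::nat}" "{Suc 0..2} = {Suc 0, 2::nat}"
  by auto

text \<open>
  Turns irreducibility into a comparison of the letters in the initial segments of the two rows.
\<close>

lemma prefix_image:
  fixes n k :: nat
  assumes "bij_betw p A {1..n}" "k \<le> n"
  shows "(q \<circ> inv_into A p) ` {1..k} = q ` {\<alpha>\<in>A. p \<alpha> \<le> k}"
proof -
  have "inv_into A p ` {1..k} = {\<alpha>\<in>A. p \<alpha> \<le> k}"
  proof -
    have "{1..k} = p ` {\<alpha>\<in>A. p \<alpha> \<le> k}"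
    proof -
      have "{1..k} = {1..n} \<inter> {..k}" using assms(2) by auto
      also have "{1..n} = p ` A" using assms(1) by (simp add: bij_betw_def)
      finally show ?thesis by auto
    qed
    then show ?thesis
      using assms(1) by (simp add: bij_betw_def inv_into_image_cancel)
  qed
  then show ?thesis by (simp only: image_comp[symmetric])
qed

lemma card_three: "card {1, 2, 3::nat} = 3"
  by simp

lemma row_bij_betw:
  assumes "{u, v, w} = {1, 2, 3::nat}"
  shows "bij_betw (row u v w) {1, 2, 3} {1..3}"
proof -
  have "row u v w ` {1, 2, 3} = {1..3}"
    using assms by (simp add: interval_simps)
  moreover from this have "inj_on (row u v w) {1, 2, 3}"
    by (intro eq_card_imp_inj_on) (simp_all only: card_three card_atLeastAtMost, simp_all)
  ultimately show ?thesis
    unfolding bij_betw_def by blast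
qed

lemma inv_into_row:
  assumes "{u, v, w} = {1, 2, 3::nat}" "\<alpha> \<in> {1, 2, 3}" "row u v w \<alpha> = i"
  shows "inv_into {1, 2, 3} (row u v w) i = \<alpha>"
  using row_bij_betw[OF assms(1)] assms(2,3) by (metis bij_betw_def inv_into_f_f)

lemma irreducible_rows:
  fixes p0 p1 :: "nat \<Rightarrow> nat"
  assumes p0: "p0 = row i j k" "{i, j, k} = {1, 2, 3}"
    and p1: "p1 = row i' j' k'" "{i', j', k'} = {1, 2, 3}"
    and pre: "\<And>m. m \<in> {1, 2} \<Longrightarrow> p1 ` {\<alpha>\<in>{1, 2, 3}. p0 \<alpha> \<le> m} \<noteq> {1..m}"
  shows "(p0, p1) \<in> irreducible_perms {1, 2, 3}"
proof -
  have b: "bij_betw p0 {1, 2, 3} {1..3}" "bij_betw p1 {1, 2, 3} {1..3}"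
    using assms row_bij_betw by metis+
  have "m = 3" if m: "m \<in> {1..3}" and "(p1 \<circ> inv_into {1, 2, 3} p0) ` {1..m} = {1..m}" for m
  proof (rule ccontr)
    assume "m \<noteq> 3"
    then have "m \<in> {1, 2}" "m \<le> 3" using m by auto
    then show False using pre[of m] that(2) prefix_image[OF b(1), of m p1] by simp
  qed
  moreover have "p0 \<in> extensional {1, 2, 3}" "p1 \<in> extensional {1, 2, 3}"
    using p0(1) p1(1) by simp_all
  ultimately show ?thesis
    using b unfolding irreducible_perms_def card_three by blast
qed

text \<open>
  The form in which the cone conditions and the vertices of the polygon are evaluated.
\<close>

lemma sum_prefix:
  fixes f :: "nat \<Rightarrow> 'b::comm_monoid_add" and p :: "nat \<Rightarrow> nat"
  shows "(\<Sum>\<alpha> | \<alpha> \<in> {1, 2, 3} \<and> p \<alpha> \<le> k. f \<alpha>) =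
    (if p 1 \<le> k then f 1 else 0) + ((if p 2 \<le> k then f 2 else 0) + (if p 3 \<le> k then f 3 else 0))"
  by (subst sum.inter_filter) simp_all

lemma three_letter_suspension_data:
  assumes "a > 0" "b > 0" "c > 0" "x > 0" "y > 0"
  shows "((row 1 2 3, row 3 2 1), row a b c, row x 0 (- y)) \<in> suspension_data {1, 2, 3}"
    and "x < y \<Longrightarrow> ((row 1 2 3, row 2 3 1), row a b c, row x 0 (- y)) \<in> suspension_data {1, 2, 3}"
    and "y < x \<Longrightarrow> ((row 1 3 2, row 3 2 1), row a b c, row x 0 (- y)) \<in> suspension_data {1, 2, 3}"
proof -
  have len: "row a b c \<in> {1, 2, 3} \<rightarrow>\<^sub>E {0<..}"
    using assms by (simp add: PiE_def)
  \<comment> \<open>Evaluates the prefixes of a row for the test of irreducibility.\<close>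
  have set_simps: "{\<alpha>. (\<alpha> = Suc 0 \<or> \<alpha> = 2 \<or> \<alpha> = 3) \<and> P \<alpha>} =
      (if P (Suc 0) then {Suc 0} else {}) \<union> (if P 2 then {2} else {}) \<union> (if P 3 then {3} else {})" for P
    by auto
  have irr: "(row 1 2 3, row 3 2 1) \<in> irreducible_perms {1, 2, 3}"
    "(row 1 2 3, row 2 3 1) \<in> irreducible_perms {1, 2, 3}"
    "(row 1 3 2, row 3 2 1) \<in> irreducible_perms {1, 2, 3}"
    by (rule irreducible_rows[OF refl _ refl]; auto simp: set_simps interval_simps doubleton_eq_iff)+
  have k: "{1..card {1, 2, 3::nat} - 1} = {1, 2}"
    by (auto simp: card_three)
  have cone: "row x 0 (- y) \<in> suspension_cone {1, 2, 3} (row 1 2 3, row 3 2 1)"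
    "x < y \<Longrightarrow> row x 0 (- y) \<in> suspension_cone {1, 2, 3} (row 1 2 3, row 2 3 1)"
    "y < x \<Longrightarrow> row x 0 (- y) \<in> suspension_cone {1, 2, 3} (row 1 3 2, row 3 2 1)"
    using assms unfolding suspension_cone_def k sum_prefix by simp_all
  show "((row 1 2 3, row 3 2 1), row a b c, row x 0 (- y)) \<in> suspension_data {1, 2, 3}"
    "x < y \<Longrightarrow> ((row 1 2 3, row 2 3 1), row a b c, row x 0 (- y)) \<in> suspension_data {1, 2, 3}"
    "y < x \<Longrightarrow> ((row 1 3 2, row 3 2 1), row a b c, row x 0 (- y)) \<in> suspension_data {1, 2, 3}"
    using irr len cone unfolding suspension_data_def by simp_all
qed

text \<open>
  The first two steps undo each other's effect on the permutation and are of top type: the winner is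
  \<open>3\<close>, and the loser is \<open>2\<close> and then \<open>1\<close>. The other two are of bottom type, with winner \<open>1\<close> and losers
  \<open>2\<close> and \<open>3\<close>. When \<open>2\<close> loses, \<open>\<tau>\<close> does not change because \<open>\<tau>\<^sub>2 = 0\<close>.
\<close>

lemma three_letter_rauzy_veech:
  assumes "a > 0" "b > 0" "c > 0"
  shows "rauzy_veech {1, 2, 3} ((row 1 2 3, row 2 3 1), row a b (c + b), row x 0 (- y))
      = Some ((row 1 2 3, row 3 2 1), row a b c, row x 0 (- y))"
    and "rauzy_veech {1, 2, 3} ((row 1 2 3, row 3 2 1), row a b (c + a), row x 0 (- (y - x)))
      = Some ((row 1 2 3, row 2 3 1), row a b c, row x 0 (- y))"
    and "rauzy_veech {1, 2, 3} ((row 1 3 2, row 3 2 1), row (a + b) b c, row x 0 (- y))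
      = Some ((row 1 2 3, row 3 2 1), row a b c, row x 0 (- y))"
    and "rauzy_veech {1, 2, 3} ((row 1 2 3, row 3 2 1), row (a + c) b c, row (x - y) 0 (- y))
      = Some ((row 1 3 2, row 3 2 1), row a b c, row x 0 (- y))"
proof -
  have last: "inv_into {1, 2, 3} (row 1 2 3) (3::nat) = 3" "inv_into {1, 2, 3} (row 1 3 2) (3::nat) = 2"
    "inv_into {1, 2, 3} (row 3 2 1) (3::nat) = 1" "inv_into {1, 2, 3} (row 2 3 1) (3::nat) = 2"
    by (rule inv_into_row; auto)+
  have upd: "(row u v w)(1 := u') = row u' v w" "(row u v w)(3 := u') = row u v u'" for u v w u' :: real
    by (auto simp: row_def)
  have move: "move_after {1, 2, 3} (row 2 3 1) 3 2 = row 3 2 1"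
    "move_after {1, 2, 3} (row 3 2 1) 3 1 = row 2 3 1"
    "move_after {1, 2, 3} (row 1 3 2) 1 2 = row 1 2 3"
    "move_after {1, 2, 3} (row 1 2 3) 1 3 = row 1 3 2"
    by (rule row_eqI; simp add: move_after_def)+
  show "rauzy_veech {1, 2, 3} ((row 1 2 3, row 2 3 1), row a b (c + b), row x 0 (- y))
      = Some ((row 1 2 3, row 3 2 1), row a b c, row x 0 (- y))"
    "rauzy_veech {1, 2, 3} ((row 1 2 3, row 3 2 1), row a b (c + a), row x 0 (- (y - x)))
      = Some ((row 1 2 3, row 2 3 1), row a b c, row x 0 (- y))"
    "rauzy_veech {1, 2, 3} ((row 1 3 2, row 3 2 1), row (a + b) b c, row x 0 (- y))
      = Some ((row 1 2 3, row 3 2 1), row a b c, row x 0 (- y))"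
    "rauzy_veech {1, 2, 3} ((row 1 2 3, row 3 2 1), row (a + c) b c, row (x - y) 0 (- y))
      = Some ((row 1 3 2, row 3 2 1), row a b c, row x 0 (- y))"
    using assms unfolding rauzy_veech_def card_three
    by (simp_all add: last[simplified] upd[simplified] move[simplified])
qed

text \<open>
  The stages of the backward algorithm. The central permutation \<open>(1 2 3 / 3 2 1)\<close> is left for
  \<open>(1 2 3 / 3 1 2)\<close> or \<open>(1 3 2 / 3 2 1)\<close> according to the sign of \<open>x - y\<close>, and the next step comes back
  to it with \<open>(x, y - x)\<close> or \<open>(x - y, y)\<close>. In the intermediate stages the order of \<open>x\<close> and \<open>y\<close> is
  recorded, as the suspension cone requires it.
\<close>

inductive euclid_datum :: "nat datum \<Rightarrow> bool" where
  central: "\<lbrakk>a > 0; b > 0; c > 0; x > 0; y > 0; x / y \<notin> \<rat>\<rbrakk> \<Longrightarrow>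
    euclid_datum ((row 1 2 3, row 3 2 1), row a b c, row x 0 (- y))"
| negative_sum: "\<lbrakk>a > 0; b > 0; c > 0; x > 0; x < y; x / y \<notin> \<rat>\<rbrakk> \<Longrightarrow>
    euclid_datum ((row 1 2 3, row 2 3 1), row a b c, row x 0 (- y))"
| positive_sum: "\<lbrakk>a > 0; b > 0; c > 0; y > 0; y < x; x / y \<notin> \<rat>\<rbrakk> \<Longrightarrow>
    euclid_datum ((row 1 3 2, row 3 2 1), row a b c, row x 0 (- y))"

lemma euclid_datum_step:
  assumes "euclid_datum T"
  obtains T' where "rauzy_veech_inv {1, 2, 3} T = Some T'" "euclid_datum T'"
proof -
  have invI: "rauzy_veech_inv {1, 2, 3} U = Some T"
    if "T \<in> suspension_data {1, 2, 3}" "rauzy_veech {1, 2, 3} T = Some U" for T U :: "nat datum"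
    using rauzy_veech_inv_eqI[OF _ _ that] by simp
  note data = three_letter_suspension_data
  note rv = three_letter_rauzy_veech
  have "\<exists>T'. rauzy_veech_inv {1, 2, 3} T = Some T' \<and> euclid_datum T'"
    using assms
  proof cases
    case (central a b c x y)
    have "x \<noteq> y" using central by auto
    then consider "x < y" | "y < x" by linarith
    then show ?thesis
    proof cases
      case 1
      with central show ?thesis
        using invI[OF data(2)[of a b "c + b" x y] rv(1)[of a b c x y]]
          euclid_datum.negative_sum[of a b "c + b" x y] by auto
    next
      case 2
      with central show ?thesis
        using invI[OF data(3)[of "a + b" b c x y] rv(3)[of a b c x y]]
          euclid_datum.positive_sum[of "a + b" b c y x] by auto
    qed
  next
    case (negative_sum a b c x y)
    \<comment> \<open>The reciprocals of the two quotients differ by \<open>1\<close>.\<close>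
    have "x / (y - x) \<notin> \<rat>"
    proof
      assume "x / (y - x) \<in> \<rat>"
      then have "inverse (inverse (x / (y - x)) + 1) \<in> \<rat>"
        by (intro Rats_inverse Rats_add Rats_1)
      moreover have "inverse (inverse (x / (y - x)) + 1) = x / y"
        using negative_sum by (simp add: field_simps)
      ultimately show False using negative_sum by metis
    qed
    with negative_sum show ?thesis
      using invI[OF data(1)[of a b "c + a" x "y - x"] rv(2)[of a b c x y]]
          euclid_datum.central[of a b "c + a" x "y - x"]
      by auto
  next
    case (positive_sum a b c y x)
    have "(x - y) / y \<notin> \<rat>"
    proof
      assume "(x - y) / y \<in> \<rat>"
      then have "(x - y) / y + 1 \<in> \<rat>" by auto
      then show False using positive_sum by (simp add: field_simps)
    qed
    with positive_sum show ?thesis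
      using invI[OF data(1)[of "a + c" b c "x - y" y] rv(4)[of a b c x y]]
        euclid_datum.central[of "a + c" b c "x - y" y]
      by auto
  qed
  then show thesis using that by blast
qed

lemma euclid_datum_inv_iter:
  assumes "euclid_datum T"
  shows "\<exists>T'. rauzy_veech_inv_iter {1, 2, 3} n T = Some T' \<and> euclid_datum T'"
proof (induction n)
  case 0
  then show ?case using assms by simp
next
  case (Suc n)
  then obtain T' where "rauzy_veech_inv_iter {1, 2, 3} n T = Some T'" "euclid_datum T'" by blast
  then show ?case by (auto elim: euclid_datum_step)
qed

section \<open>Horizontal segments in the polygon\<close>

lemma gluing_refl: "z \<in> polygon A T \<Longrightarrow> z \<in> gluing A T `` {z}"
  by (simp add: gluing_def)

lemma class_in_surface: "z \<in> polygon A T \<Longrightarrow> gluing A T `` {z} \<in> surface A T"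
  unfolding surface_def by (rule quotientI)

text \<open>
  Inside the polygon the flow crosses no side, so the translates of one representative serve on both
  sides of every time.
\<close>

lemma flows_along_segment:
  assumes seg: "\<And>s. s \<in> closed_segment 0 t \<Longrightarrow> z + of_real s \<in> polygon A T"
    and reg: "\<And>s. s \<in> open_segment 0 t \<Longrightarrow> gluing A T `` {z + of_real s} \<notin> singularities A T"
  shows "flows_to A T (gluing A T `` {z}) t (gluing A T `` {z + of_real t})"
proof -
  let ?\<gamma> = "\<lambda>s. gluing A T `` {z + of_real s}"
  have "horizontal_motion A T ?\<gamma> (closed_segment 0 t)"
    unfolding horizontal_motion_def
  proof (intro conjI ballI)
    show "?\<gamma> ` closed_segment 0 t \<subseteq> surface A T"
      using seg class_in_surface by blast
    fix r assume "r \<in> closed_segment 0 t"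
    then have r: "z + of_real r \<in> ?\<gamma> r"
      using seg gluing_refl by blast
    have eq: "?\<gamma> s = gluing A T `` {z + of_real r + of_real (s - r)}" for s
      by simp
    show "\<exists>w\<in>?\<gamma> r. \<exists>\<epsilon>>0. \<forall>s\<in>closed_segment 0 t \<inter> {r..<r + \<epsilon>}. ?\<gamma> s = gluing A T `` {w + of_real (s - r)}"
      "\<exists>w\<in>?\<gamma> r. \<exists>\<epsilon>>0. \<forall>s\<in>closed_segment 0 t \<inter> {r - \<epsilon><..r}. ?\<gamma> s = gluing A T `` {w + of_real (s - r)}"
      using r eq zero_less_one by blast+
  qed
  then show ?thesis
    unfolding flows_to_def using reg by (intro exI[of _ ?\<gamma>]) simp
qed

text \<open>
  The separatrix is the orbit of the midpoint, which reaches the two ends in time \<open>h / 2\<close> and \<open>- h / 2\<close>.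
\<close>

lemma horizontal_segment_saddle_connection:
  assumes h: "h > 0"
    and seg: "\<And>s. 0 \<le> s \<Longrightarrow> s \<le> h \<Longrightarrow> z + of_real s \<in> polygon A T"
    and ends: "gluing A T `` {z} \<in> singularities A T"
      "gluing A T `` {z + of_real h} \<in> singularities A T"
    and reg: "\<And>s. 0 < s \<Longrightarrow> s < h \<Longrightarrow> gluing A T `` {z + of_real s} \<notin> singularities A T"
  shows "\<exists>orb. horizontal_saddle_connection A T orb"
proof -
  define w where "w = z + of_real (h / 2)"
  let ?p = "gluing A T `` {w}"
  have w: "w + of_real s = z + of_real (h / 2 + s)" for s
    by (simp add: w_def)
  have p: "?p \<in> surface A T - singularities A T"
    using h seg[of "h / 2"] reg[of "h / 2"] class_in_surface unfolding w_def by simp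
  have "flows_to A T ?p (h / 2) (gluing A T `` {w + of_real (h / 2)})"
    by (rule flows_along_segment; unfold w; rule seg reg)
      (use h in \<open>auto simp: closed_segment_eq_real_ivl open_segment_eq_real_ivl\<close>)
  moreover have "flows_to A T ?p (- (h / 2)) (gluing A T `` {w + of_real (- (h / 2))})"
    by (rule flows_along_segment; unfold w; rule seg reg)
      (use h in \<open>auto simp: closed_segment_eq_real_ivl open_segment_eq_real_ivl\<close>)
  moreover have "w + of_real (h / 2) = z + of_real h" "w + of_real (- (h / 2)) = z"
    unfolding w by simp_all
  ultimately have "leftward_separatrix A T (horizontal_orbit A T ?p)"
    "rightward_separatrix A T (horizontal_orbit A T ?p)"
    unfolding leftward_separatrix_def rightward_separatrix_def
    using p ends h by (metis half_gt_zero, metis half_gt_zero neg_less_0_iff_less)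
  then show ?thesis
    unfolding horizontal_saddle_connection_def by blast
qed

text \<open>
  Classes are generated by the side pairing alone, so a property preserved by it distinguishes
  classes without any computation of the transitive closure.
\<close>

lemma gluing_invariant:
  assumes step: "\<And>u v. (u, v) \<in> side_pairing A T \<Longrightarrow> P u \<longleftrightarrow> P v"
    and z: "z \<in> polygon A T" and eq: "gluing A T `` {v} = gluing A T `` {z}"
  shows "P v \<longleftrightarrow> P z"
proof -
  have "(v, z) \<in> (side_pairing A T \<union> (side_pairing A T)\<inverse>)\<^sup>*"
    using gluing_refl[OF z] eq unfolding gluing_def by blast
  then show ?thesis
    by (induction rule: rtrancl_induct) (use step in auto)
qed

section \<open>A surface with a horizontal side\<close>

definition flat_datum :: "real \<Rightarrow> real \<Rightarrow> nat datum" where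
  "flat_datum x y = ((row 1 2 3, row 3 2 1), row 1 1 1, row x 0 (- y))"

lemma flat_vertices:
  "vertex {1, 2, 3} (row 1 2 3) (row 1 1 1) (row x 0 (- y)) 0 = 0"
  "vertex {1, 2, 3} (row 1 2 3) (row 1 1 1) (row x 0 (- y)) (Suc 0) = Complex 1 x"
  "vertex {1, 2, 3} (row 1 2 3) (row 1 1 1) (row x 0 (- y)) 2 = Complex 2 x"
  "vertex {1, 2, 3} (row 1 2 3) (row 1 1 1) (row x 0 (- y)) 3 = Complex 3 (x - y)"
  "vertex {1, 2, 3} (row 3 2 1) (row 1 1 1) (row x 0 (- y)) 0 = 0"
  "vertex {1, 2, 3} (row 3 2 1) (row 1 1 1) (row x 0 (- y)) (Suc 0) = Complex 1 (- y)"
  "vertex {1, 2, 3} (row 3 2 1) (row 1 1 1) (row x 0 (- y)) 2 = Complex 2 (- y)"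
  "vertex {1, 2, 3} (row 3 2 1) (row 1 1 1) (row x 0 (- y)) 3 = Complex 3 (x - y)"
  unfolding vertex_def sum_prefix by (simp_all add: complex_eq_iff)

lemma broken_line_three:
  fixes p :: "nat \<Rightarrow> nat"
  shows "broken_line {1, 2, 3} p len \<tau> =
     closed_segment (vertex {1, 2, 3} p len \<tau> 0) (vertex {1, 2, 3} p len \<tau> 1) \<union>
     closed_segment (vertex {1, 2, 3} p len \<tau> 1) (vertex {1, 2, 3} p len \<tau> 2) \<union>
     closed_segment (vertex {1, 2, 3} p len \<tau> 2) (vertex {1, 2, 3} p len \<tau> 3)"
proof -
  have "{1..card {1, 2, 3::nat}} = {1, 2, 3}"
    by (auto simp: card_three)
  then show ?thesis
    by (simp add: broken_line_def Un_assoc)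
qed

lemma flat_broken_lines:
  "broken_line {1, 2, 3} (row 1 2 3) (row 1 1 1) (row x 0 (- y)) =
     closed_segment 0 (Complex 1 x) \<union> closed_segment (Complex 1 x) (Complex 2 x) \<union>
     closed_segment (Complex 2 x) (Complex 3 (x - y))"
  "broken_line {1, 2, 3} (row 3 2 1) (row 1 1 1) (row x 0 (- y)) =
     closed_segment 0 (Complex 1 (- y)) \<union> closed_segment (Complex 1 (- y)) (Complex 2 (- y)) \<union>
     closed_segment (Complex 2 (- y)) (Complex 3 (x - y))"
  by (simp_all only: broken_line_three) (simp_all add: flat_vertices[simplified])

text \<open>
  All sides have horizontal extent \<open>1\<close>, so on each of them the imaginary part is given by
  the real part without a division.
\<close>

lemma unit_step_segment:
  assumes "z \<in> closed_segment u v" "Re v = Re u + 1"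
  shows "Re u \<le> Re z \<and> Re z \<le> Re u + 1 \<and> Im z = Im u + (Re z - Re u) * (Im v - Im u)"
proof -
  obtain r where r: "0 \<le> r" "r \<le> 1" "z = (1 - r) *\<^sub>R u + r *\<^sub>R v"
    using assms(1) unfolding in_segment by blast
  have "Re z = Re u + r"
    unfolding r(3) using assms(2) by (simp add: algebra_simps)
  moreover have "Im z = Im u + r * (Im v - Im u)"
    unfolding r(3) by (simp add: algebra_simps)
  ultimately show ?thesis
    using r(1,2) by simp
qed

lemma flat_bounds_polygon:
  assumes "x > 0" "y > 0"
  shows "bounds_polygon {1, 2, 3} (flat_datum x y)"
proof -
  let ?top = "broken_line {1, 2, 3} (row 1 2 3) (row 1 1 1) (row x 0 (- y))"
  let ?bot = "broken_line {1, 2, 3} (row 3 2 1) (row 1 1 1) (row x 0 (- y))"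
  have "z = 0 \<or> z = Complex 3 (x - y)" if "z \<in> ?top" "z \<in> ?bot" for z
  proof -
    have top: "0 \<le> Re z \<and> Re z \<le> 1 \<and> Im z = Re z * x \<or> 1 \<le> Re z \<and> Re z \<le> 2 \<and> Im z = x
      \<or> 2 \<le> Re z \<and> Re z \<le> 3 \<and> Im z = x - (Re z - 2) * y"
      using that(1) unfolding flat_broken_lines by (auto dest!: unit_step_segment)
    have bot: "0 \<le> Re z \<and> Re z \<le> 1 \<and> Im z = - (Re z * y) \<or> 1 \<le> Re z \<and> Re z \<le> 2 \<and> Im z = - y
      \<or> 2 \<le> Re z \<and> Re z \<le> 3 \<and> Im z = (Re z - 2) * x - y"
      using that(2) unfolding flat_broken_lines by (auto dest!: unit_step_segment)
    consider "Re z \<le> 1" | "1 < Re z" "Re z < 2" | "Re z \<ge> 2"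
      by linarith
    then have "Re z = 0 \<and> Im z = 0 \<or> Re z = 3 \<and> Im z = x - y"
    proof cases
      case 1
      then have eq: "Im z = Re z * x" "Im z = - (Re z * y)"
        using top bot by (cases "Re z = 1"; simp)+
      then have "Re z * (x + y) = 0"
        by (simp add: algebra_simps)
      then show ?thesis
        using assms eq by simp
    next
      case 2
      then show ?thesis
        using top bot assms by simp
    next
      case 3
      then have eq: "Im z = x - (Re z - 2) * y" "Im z = (Re z - 2) * x - y"
        using top bot by (cases "Re z = 2"; simp)+
      then have "(Re z - 3) * (x + y) = 0"
        by (simp add: algebra_simps)
      then show ?thesis
        using assms eq by simp
    qed
    then show ?thesis by (auto simp: complex_eq_iff)
  qed
  moreover have "{0, Complex 3 (x - y)} \<subseteq> ?top \<inter> ?bot"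
    unfolding flat_broken_lines by simp
  ultimately have "?top \<inter> ?bot = {0, Complex 3 (x - y)}"
    by blast
  then show ?thesis
    unfolding bounds_polygon_def flat_datum_def card_three using flat_vertices by simp
qed

text \<open>
  The two copies of the side \<open>2\<close> have the same real parts. The sides \<open>1\<close> and \<open>3\<close> have real parts in
  \<open>[0, 1]\<close> on one broken line and in \<open>[2, 3]\<close> on the other, so their points stay outside the strip.
\<close>

lemma flat_pairing_middle:
  assumes "(u, v) \<in> side_pairing {1, 2, 3} (flat_datum x y)"
  shows "1 < Re u \<and> Re u < 2 \<longleftrightarrow> 1 < Re v \<and> Re v < 2"
proof -
  from assms obtain \<alpha> where \<alpha>: "\<alpha> \<in> {1, 2, 3}"
    and u: "u \<in> side {1, 2, 3} (row 1 2 3) (row 1 1 1) (row x 0 (- y)) \<alpha>"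
    and v: "v = u + (vertex {1, 2, 3} (row 3 2 1) (row 1 1 1) (row x 0 (- y)) (row 3 2 1 \<alpha> - 1)
      - vertex {1, 2, 3} (row 1 2 3) (row 1 1 1) (row x 0 (- y)) (row 1 2 3 \<alpha> - 1))"
    unfolding side_pairing_def flat_datum_def by auto
  from \<alpha> consider "\<alpha> = 1" | "\<alpha> = 2" | "\<alpha> = 3" by auto
  then show ?thesis
    using u v by cases (auto simp: side_def flat_vertices[simplified] dest!: unit_step_segment)
qed

lemma flat_singularity_vertex:
  assumes "c \<in> singularities {1, 2, 3} (flat_datum x y)"
  obtains v where "c = gluing {1, 2, 3} (flat_datum x y) `` {v}" "Re v \<in> {0, 1, 2, 3}"
proof -
  have k: "{0..card {1, 2, 3::nat}} = {0, 1, 2, 3}"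
    by (auto simp: card_three)
  have "\<exists>v. c = gluing {1, 2, 3} (flat_datum x y) `` {v} \<and> Re v \<in> {0, 1, 2, 3}"
    using assms unfolding singularities_def flat_datum_def k
    by (simp add: flat_vertices[simplified])
      (elim disjE; force intro: exI[of _ 0] exI[of _ "Complex 1 x"] exI[of _ "Complex 2 x"]
        exI[of _ "Complex 3 (x - y)"] exI[of _ "Complex 1 (- y)"] exI[of _ "Complex 2 (- y)"])
  with that show ?thesis by blast
qed

lemma flat_middle_regular:
  assumes "z \<in> polygon {1, 2, 3} (flat_datum x y)" "1 < Re z" "Re z < 2"
  shows "gluing {1, 2, 3} (flat_datum x y) `` {z} \<notin> singularities {1, 2, 3} (flat_datum x y)"
proof
  assume "gluing {1, 2, 3} (flat_datum x y) `` {z} \<in> singularities {1, 2, 3} (flat_datum x y)"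
  then obtain v where "gluing {1, 2, 3} (flat_datum x y) `` {v} = gluing {1, 2, 3} (flat_datum x y) `` {z}"
    and v: "Re v \<in> {0, 1, 2, 3}"
    using flat_singularity_vertex by metis
  then have "1 < Re v \<and> Re v < 2"
    using gluing_invariant[where P = "\<lambda>u. 1 < Re u \<and> Re u < 2", OF flat_pairing_middle[of _ _ x y] assms(1)]
      assms(2,3) by blast
  with v show False by auto
qed

lemma flat_saddle_connection:
  "\<exists>orb. horizontal_saddle_connection {1, 2, 3} (flat_datum x y) orb"
proof (rule horizontal_segment_saddle_connection)
  show "(0::real) < 1" by simp
  have k: "{0..card {1, 2, 3::nat}} = {0, 1, 2, 3}"
    by (auto simp: card_three)
  show seg: "Complex 1 x + of_real s \<in> polygon {1, 2, 3} (flat_datum x y)" if "0 \<le> s" "s \<le> 1" for s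
  proof -
    have "Complex 1 x + of_real s = (1 - s) *\<^sub>R Complex 1 x + s *\<^sub>R Complex 2 x"
      by (simp add: complex_eq_iff algebra_simps)
    then have "Complex 1 x + of_real s \<in> closed_segment (Complex 1 x) (Complex 2 x)"
      using that unfolding in_segment by blast
    then show ?thesis
      unfolding polygon_def flat_datum_def by (simp add: Let_def flat_broken_lines[simplified])
  qed
  have "Complex 1 x + of_real 1 = Complex 2 x" by (simp add: complex_eq_iff)
  then show "gluing {1, 2, 3} (flat_datum x y) `` {Complex 1 x} \<in> singularities {1, 2, 3} (flat_datum x y)"
    "gluing {1, 2, 3} (flat_datum x y) `` {Complex 1 x + of_real 1} \<in> singularities {1, 2, 3} (flat_datum x y)"
    unfolding singularities_def flat_datum_def k
    by (simp_all add: flat_vertices[simplified])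
  show "gluing {1, 2, 3} (flat_datum x y) `` {Complex 1 x + of_real s} \<notin> singularities {1, 2, 3} (flat_datum x y)"
    if "0 < s" "s < 1" for s
    using flat_middle_regular seg that by simp
qed

theorem proposition6:
  "\<exists>(A :: nat set) \<pi> len \<tau>.
     finite A \<and> card A \<ge> 2 \<and>
     \<pi> \<in> irreducible_perms A \<and> len \<in> A \<rightarrow>\<^sub>E {0<..} \<and> \<tau> \<in> suspension_cone A \<pi> \<and>
     bounds_polygon A (\<pi>, len, \<tau>) \<and>
     (\<exists>orb. horizontal_saddle_connection A (\<pi>, len, \<tau>) orb) \<and>
     (\<forall>n. rauzy_veech_inv_iter A n (\<pi>, len, \<tau>) \<noteq> None)"
proof -
  \<comment> \<open>Any positive irrational ratio will do; here \<open>y = 1\<close>.\<close>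
  have "uncountable ({0<..<1} - \<rat> :: real set)"
    by (simp add: uncountable_minus_countable uncountable_open_interval countable_rat)
  then have "{0<..<1} - \<rat> \<noteq> ({} :: real set)"
    using countable_empty by metis
  then obtain x :: real where x: "0 < x" "x \<notin> \<rat>"
    by (metis DiffE ex_in_conv greaterThanLessThan_iff)
  let ?T = "((row 1 2 3, row 3 2 1), row 1 1 1, row x 0 (- 1))"
  have "?T \<in> suspension_data {1, 2, 3}"
    using x by (intro three_letter_suspension_data) simp_all
  moreover have "rauzy_veech_inv_iter {1, 2, 3} n ?T \<noteq> None" for n
    using euclid_datum_inv_iter[OF euclid_datum.central[of 1 1 1 x 1]] x by force
  moreover have "bounds_polygon {1, 2, 3} ?T" "\<exists>orb. horizontal_saddle_connection {1, 2, 3} ?T orb"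
    using flat_bounds_polygon[of x 1] flat_saddle_connection[of x 1] x by (simp_all add: flat_datum_def)
  ultimately show ?thesis
    by (intro exI[of _ "{1, 2, 3::nat}"] exI[of _ "(row 1 2 3, row 3 2 1)"] exI[of _ "row 1 1 1"]
      exI[of _ "row x 0 (- 1)"]) (simp add: suspension_data_def)
qed

end
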